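(* Let $n\ge4$ and let $\ell$ be a positive integer with $\ell\ne1$ and $\ell\mid n$. Let $S=\{1,2,\dots,n\}$ and let $P_n$ be the $n\times n$ stochastic matrix all of whose entries equal $1/n$. Then there exists a probability measure $\mu$ on the set of functions $S\to S$ such that $\mu$ is consistent with $P_n$, $\mu$ is not a block measure, and $k(\mu)=\ell$.
   Context: Let $\mathcal{F}_S$ be the set of all functions from $S$ to $S$. A probability measure $\mu$ on $\mathcal{F}_S$ is consistent with a stochastic matrix $P=(p_{i,j})$ on $S$ if $p_{i,j}=\mu(\{f\in\mathcal{F}_S: f(i)=j\})$ for all $i,j\in S$. Coalescence: let $F_1,F_2,\dots$ be independent random functions with law $\mu$, and let $X^i_0=i$ and $X^i_t=F_t\circ F_{t-1}\circ\cdots\circ F_1(i)$ for $i\in S$, $t\ge1$. Write $i\sim j$ if $X^i_t=X^j_t$ for some $t\ge 0$. This is a random equivalence relation on $S$; its equivalence classes are called coalescence classes. The number of coalescence classes is almost surely equal to a constant, which is denoted $k(\mu)$. Block measure: for a partition $\mathcal{S}=\{S_r:r\in I\}$ of $S$ into non-empty blocks with index set $I=\{1,\dots,m\}$, $\mu$ is an $\mathcal{S}$-block measure if (a) for every $f$ in the support of $\mu$ there exists a unique permutation $\pi=\pi_f$ of $I$ such that $f(S_r)\subseteq S_{\pi(r)}$ for all $r\in I$, and (b) $k(\mu)=m$. A measure $\mu$ is a block measure if it is an $\mathcal{S}$-block measure for some partition $\mathcal{S}$ of $S$.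
   Formalization: The case ℓ = n is excluded, because there the claim is false: if k(μ) = n, every f in the support of μ is a permutation of S, so μ is a block measure for the partition of S into singletons. *)

theory Defs
  imports "HOL-Probability.Probability"
begin

text \<open>
  For finite \<open>S\<close> the set of functions from \<open>S\<close> to \<open>S\<close> is rendered as the finite set
  \<open>S \<rightarrow>\<^sub>E S\<close> of extensional functions, and a probability measure on it as a \<open>pmf\<close> whose
  support lies in that set.
\<close>

definition measure_on_self_maps :: "'a set \<Rightarrow> ('a \<Rightarrow> 'a) pmf \<Rightarrow> bool" where
  "measure_on_self_maps S \<mu> \<longleftrightarrow> set_pmf \<mu> \<subseteq> (S \<rightarrow>\<^sub>E S)"

definition consistent :: "'a set \<Rightarrow> ('a \<Rightarrow> 'a) pmf \<Rightarrow> ('a \<Rightarrow> 'a \<Rightarrow> real) \<Rightarrow> bool" where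
  "consistent S \<mu> P \<longleftrightarrow> (\<forall>i\<in>S. \<forall>j\<in>S. P i j = measure_pmf.prob \<mu> {f \<in> S \<rightarrow>\<^sub>E S. f i = j})"

definition uniform_matrix :: "nat \<Rightarrow> nat \<Rightarrow> nat \<Rightarrow> real" where
  "uniform_matrix n i j = 1 / real n"


text \<open>
  The independent random functions \<open>F\<^sub>1, F\<^sub>2, \<dots>\<close> are the coordinates of the product space below;
  the coordinate with index \<open>t\<close> plays the role of \<open>F\<^bsub>t+1\<^esub>\<close>.
\<close>

definition iid_maps :: "('a \<Rightarrow> 'a) pmf \<Rightarrow> (nat \<Rightarrow> 'a \<Rightarrow> 'a) measure" where
  "iid_maps \<mu> = (\<Pi>\<^sub>M t\<in>UNIV. measure_pmf \<mu>)"

primrec trajectory :: "(nat \<Rightarrow> 'a \<Rightarrow> 'a) \<Rightarrow> nat \<Rightarrow> 'a \<Rightarrow> 'a" where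
  "trajectory F 0 i = i"
| "trajectory F (Suc t) i = F t (trajectory F t i)"

definition coalescence_rel :: "'a set \<Rightarrow> (nat \<Rightarrow> 'a \<Rightarrow> 'a) \<Rightarrow> 'a rel" where
  "coalescence_rel S F =
     {(i, j). i \<in> S \<and> j \<in> S \<and> (\<exists>t. trajectory F t i = trajectory F t j)}"

text \<open>
  The description below is justified by \<open>AE_coalescence_number\<close>: for finite \<open>S\<close> and a measure
  on the self-maps of \<open>S\<close>, such a \<open>k\<close> exists, and it is clearly unique.
\<close>

definition coalescence_number :: "'a set \<Rightarrow> ('a \<Rightarrow> 'a) pmf \<Rightarrow> nat" where
  "coalescence_number S \<mu> = (THE k. AE F in iid_maps \<mu>. card (S // coalescence_rel S F) = k)"

definition indexed_partition :: "'a set \<Rightarrow> nat \<Rightarrow> (nat \<Rightarrow> 'a set) \<Rightarrow> bool" where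
  "indexed_partition S m B \<longleftrightarrow>
     (\<forall>r\<in>{1..m}. B r \<noteq> {}) \<and> disjoint_family_on B {1..m} \<and> (\<Union>r\<in>{1..m}. B r) = S"

definition block_measure_wrt ::
    "'a set \<Rightarrow> nat \<Rightarrow> (nat \<Rightarrow> 'a set) \<Rightarrow> ('a \<Rightarrow> 'a) pmf \<Rightarrow> bool" where
  "block_measure_wrt S m B \<mu> \<longleftrightarrow>
     (\<forall>f\<in>set_pmf \<mu>. \<exists>!\<pi>. \<pi> permutes {1..m} \<and> (\<forall>r\<in>{1..m}. f ` B r \<subseteq> B (\<pi> r))) \<and>
     coalescence_number S \<mu> = m"

definition block_measure :: "'a set \<Rightarrow> ('a \<Rightarrow> 'a) pmf \<Rightarrow> bool" where
  "block_measure S \<mu> \<longleftrightarrow>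
     (\<exists>m B. indexed_partition S m B \<and> block_measure_wrt S m B \<mu>)"


subsection \<open>The coalescence number is well defined\<close>

lemma prob_space_iid_maps: "prob_space (iid_maps \<mu>)"
  unfolding iid_maps_def by (intro prob_space_PiM) (rule measure_pmf.prob_space_axioms)

lemma AE_iid_maps_support: "AE F in iid_maps \<mu>. \<forall>t. F t \<in> set_pmf \<mu>"
  unfolding iid_maps_def AE_all_countable
  by (intro allI AE_PiM_component)
     (auto simp: measure_pmf.prob_space_axioms AE_measure_pmf)

lemma trajectory_add:
  "trajectory F (m + t) i = trajectory (\<lambda>s. F (m + s)) t (trajectory F m i)"
  by (induction t) auto

lemma equiv_coalescence_rel: "equiv S (coalescence_rel S F)"
proof (rule equivI)
  show "trans (coalescence_rel S F)"
  proof (rule transI)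
    fix x y z assume "(x, y) \<in> coalescence_rel S F" "(y, z) \<in> coalescence_rel S F"
    then obtain s t where st: "trajectory F s x = trajectory F s y"
        "trajectory F t y = trajectory F t z" and xz: "x \<in> S" "z \<in> S"
      by (auto simp: coalescence_rel_def)
    have "trajectory F (s + t) x = trajectory F (s + t) y"
      by (simp add: trajectory_add st)
    moreover have "trajectory F (t + s) y = trajectory F (t + s) z"
      by (simp add: trajectory_add st)
    ultimately have "trajectory F (s + t) x = trajectory F (s + t) z"
      by (simp add: add.commute)
    then show "(x, z) \<in> coalescence_rel S F" using xz by (auto simp: coalescence_rel_def)
  qed
  show "sym (coalescence_rel S F)"
    unfolding coalescence_rel_def sym_def by (auto; metis)
qed (auto simp: coalescence_rel_def refl_on_def)

lemma trajectory_cong: "(\<And>s. s < t \<Longrightarrow> F s = G s) \<Longrightarrow> trajectory F t i = trajectory G t i"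
  by (induction t) auto

lemma trajectory_in:
  assumes "\<And>t. F t \<in> S \<rightarrow>\<^sub>E S" "i \<in> S"
  shows "trajectory F t i \<in> S"
  proof (induction t)
  case (Suc t)
  then show ?case using PiE_mem[OF assms(1)[of t]] by simp
qed (use assms(2) in simp)

lemma prob_word_pos:
  assumes w: "\<And>s. s < L \<Longrightarrow> w s \<in> set_pmf \<mu>"
  shows "{F \<in> space (iid_maps \<mu>). \<forall>s<L. F s = w s} \<in> sets (iid_maps \<mu>)" (is "?A \<in> _")
    and "measure (iid_maps \<mu>) {F \<in> space (iid_maps \<mu>). \<forall>s<L. F s = w s} > 0"
proof -
  interpret sequence_space "measure_pmf \<mu>" ..
  have A: "?A = prod_emb UNIV (\<lambda>_. measure_pmf \<mu>) {..<L} (\<Pi>\<^sub>E s\<in>{..<L}. {w s})"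
    by (subst prod_emb_PiE) (auto simp: iid_maps_def space_PiM PiE_iff split: if_splits)
  show "?A \<in> sets (iid_maps \<mu>)"
    unfolding A unfolding iid_maps_def by (rule sets_PiM_I) auto
  have "measure (iid_maps \<mu>) ?A = (\<Prod>s\<in>{..<L}. measure_pmf.prob \<mu> {w s})"
    unfolding A unfolding iid_maps_def by (rule measure_PiM_emb) auto
  also have "\<dots> > 0"
    using w by (intro prod_pos) (auto simp: measure_pmf_single pmf_positive)
  finally show "measure (iid_maps \<mu>) ?A > 0" .
qed

lemma AE_word_occurs:
  assumes w: "\<And>s. s < L \<Longrightarrow> w s \<in> set_pmf \<mu>"
  shows "AE F in iid_maps \<mu>. \<exists>m. \<forall>s<L. F (m + s) = w s"
proof -
  interpret sequence_space "measure_pmf \<mu>" ..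
  have S_eq: "S = iid_maps \<mu>" by (simp add: iid_maps_def)
  define A where "A = {F \<in> space S. \<forall>s<L. F s = w s}"
  define B where "B = {F \<in> space S. \<forall>m. \<not> (\<forall>s<L. F (m + s) = w s)}"
  have A: "A \<in> sets S" "measure S A > 0"
    unfolding A_def S_eq by (intro prob_word_pos w; assumption)+
  have single: "{F \<in> space S. F t = g} \<in> sets S" for t g
    using sets_Collect_single[of t UNIV "{g}" "\<lambda>_. measure_pmf \<mu>"] by simp
  have B: "B \<in> sets S"
    unfolding B_def using single by (intro sets.sets_Collect) auto
  have "emeasure S B = emeasure (distr (S \<Otimes>\<^sub>M S) S (\<lambda>(\<omega>, \<omega>'). comb_seq L \<omega> \<omega>')) B"
    by (simp add: PiM_comb_seq)
  also have "\<dots> = emeasure (S \<Otimes>\<^sub>M S)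
      ((\<lambda>(\<omega>, \<omega>'). comb_seq L \<omega> \<omega>') -` B \<inter> space (S \<Otimes>\<^sub>M S))"
    by (rule emeasure_distr[OF measurable_comb_seq B])
  also have "\<dots> \<le> emeasure (S \<Otimes>\<^sub>M S) ((space S - A) \<times> B)"
  proof (rule emeasure_mono)
    show "(space S - A) \<times> B \<in> sets (S \<Otimes>\<^sub>M S)" using A B by auto
    show "(\<lambda>(\<omega>, \<omega>'). comb_seq L \<omega> \<omega>') -` B \<inter> space (S \<Otimes>\<^sub>M S) \<subseteq> (space S - A) \<times> B"
    proof clarify
      fix \<omega> \<omega>' assume sp: "(\<omega>, \<omega>') \<in> space (S \<Otimes>\<^sub>M S)" and "comb_seq L \<omega> \<omega>' \<in> B"
      then have *: "\<not> (\<forall>s<L. comb_seq L \<omega> \<omega>' (m + s) = w s)" for m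
        by (auto simp: B_def)
      have "\<omega> \<notin> A" using *[of 0] by (auto simp: A_def comb_seq_def)
      moreover have "\<not> (\<forall>s<L. \<omega>' (m + s) = w s)" for m
        using *[of "L + m"] by (auto simp: comb_seq_def add.assoc)
      ultimately show "\<omega> \<in> space S - A \<and> \<omega>' \<in> B"
        using sp by (auto simp: B_def space_pair_measure)
    qed
  qed
  also have "\<dots> = emeasure S (space S - A) * emeasure S B"
    using A B by (intro P.emeasure_pair_measure_Times) auto
  finally have "ennreal (measure S B) \<le> ennreal (measure S (space S - A) * measure S B)"
    by (simp add: P.emeasure_eq_measure ennreal_mult)
  then have "measure S B \<le> (1 - measure S A) * measure S B"
    by (simp add: P.prob_compl[OF A(1)])
  then have "measure S A * measure S B \<le> 0" by (simp add: algebra_simps)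
  with A(2) have "measure S B = 0"
    by (meson measure_nonneg mult_pos_pos not_le less_le)
  then have "AE F in S. F \<notin> B"
    by (intro AE_not_in) (auto simp: null_sets_def B P.emeasure_eq_measure)
  then show ?thesis
    unfolding S_eq[symmetric] by (rule AE_mp) (rule AE_I2, auto simp: B_def)
qed

lemma card_quotient_kernel:
  assumes "R = {(i, j). i \<in> S \<and> j \<in> S \<and> g i = g j}"
  shows "card (S // R) = card (g ` S)"
proof -
  have "bij_betw (\<lambda>y. {j \<in> S. g j = y}) (g ` S) (S // R)"
  proof (rule bij_betw_imageI)
    show "inj_on (\<lambda>y. {j \<in> S. g j = y}) (g ` S)"
      by (rule inj_onI) blast
    have "R `` {i} = {j \<in> S. g j = g i}" if "i \<in> S" for i
      using that by (auto simp: assms)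
    then show "(\<lambda>y. {j \<in> S. g j = y}) ` g ` S = S // R"
      by (auto simp: quotient_def image_def)
  qed
  then show ?thesis by (metis bij_betw_same_card)
qed

lemma card_classes_eq_card_image:
  assumes fin: "finite S"
    and stable: "\<And>t. t \<ge> T \<Longrightarrow> card (trajectory F t ` S) = card (trajectory F T ` S)"
  shows "card (S // coalescence_rel S F) = card (trajectory F T ` S)"
proof (rule card_quotient_kernel)
  have step: "trajectory F t i = trajectory F t j"
    if "trajectory F s i = trajectory F s j" "s \<le> t" for s t i j
    using that by (metis le_add_diff_inverse trajectory_add)
  have "trajectory F T i = trajectory F T j"
    if ij: "i \<in> S" "j \<in> S" and eq: "trajectory F t i = trajectory F t j" for t i j
  proof (cases "t \<le> T")
    case True then show ?thesis using step eq by blast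
  next
    case False
    define h where "h = trajectory (\<lambda>s. F (T + s)) (t - T)"
    have h: "trajectory F t x = h (trajectory F T x)" for x
      using False trajectory_add[of F T "t - T" x] by (simp add: h_def)
    have "card (h ` trajectory F T ` S) = card (trajectory F T ` S)"
      using stable[of t] False by (simp add: h image_image)
    then have "inj_on h (trajectory F T ` S)"
      using fin by (intro eq_card_imp_inj_on) auto
    then show ?thesis using eq ij by (auto simp: h dest: inj_onD)
  qed
  then show "coalescence_rel S F =
      {(i, j). i \<in> S \<and> j \<in> S \<and> trajectory F T i = trajectory F T j}"
    by (auto simp: coalescence_rel_def)
qed

lemma AE_card_classes_constant:
  assumes fin: "finite S" and \<mu>: "measure_on_self_maps S \<mu>"
  shows "\<exists>k. AE F in iid_maps \<mu>. card (S // coalescence_rel S F) = k"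
proof -
  define Q where "Q = (\<lambda>r. \<exists>w L. (\<forall>s. w s \<in> set_pmf \<mu>) \<and> r = card (trajectory w L ` S))"
  obtain w0 where "w0 \<in> set_pmf \<mu>" using set_pmf_not_empty by fast
  then have "Q (card (trajectory (\<lambda>_. w0) 0 ` S))"
    unfolding Q_def by (intro exI[of _ "\<lambda>_. w0"] exI[of _ 0]) simp
  then have "Q (LEAST r. Q r)" by (rule LeastI)
  then obtain w L where w: "\<And>s. w s \<in> set_pmf \<mu>"
    and r: "(LEAST r. Q r) = card (trajectory w L ` S)"
    unfolding Q_def by blast
  let ?r = "card (trajectory w L ` S)"
  have "AE F in iid_maps \<mu>. card (S // coalescence_rel S F) = ?r"
    using AE_word_occurs[of L w \<mu>, OF w] AE_iid_maps_support
  proof eventually_elim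
    case (elim F)
    then obtain m where m: "\<And>s. s < L \<Longrightarrow> F (m + s) = w s" by blast
    have FS: "F t \<in> S \<rightarrow>\<^sub>E S" for t
      using elim(2) \<mu> by (auto simp: measure_on_self_maps_def)
    have ge: "?r \<le> card (trajectory F t ` S)" for t
      unfolding r[symmetric] by (rule Least_le) (use elim(2) in \<open>auto simp: Q_def\<close>)
    have "trajectory F (m + L) i = trajectory w L (trajectory F m i)" for i
      unfolding trajectory_add by (rule trajectory_cong) (use m in auto)
    then have "trajectory F (m + L) ` S \<subseteq> trajectory w L ` S"
      using trajectory_in[of F S, OF FS] by auto
    then have le: "card (trajectory F (m + L) ` S) \<le> ?r"
      using fin by (intro card_mono) auto
    have le': "card (trajectory F t ` S) \<le> card (trajectory F (m + L) ` S)" if "t \<ge> m + L" for t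
    proof -
      have "trajectory F t ` S =
          trajectory (\<lambda>s. F (m + L + s)) (t - (m + L)) ` trajectory F (m + L) ` S"
        using that trajectory_add[of F "m + L" "t - (m + L)"] by (simp add: image_image)
      then show ?thesis using fin by (simp add: card_image_le)
    qed
    have "card (S // coalescence_rel S F) = card (trajectory F (m + L) ` S)"
    proof (rule card_classes_eq_card_image[OF fin])
      show "card (trajectory F t ` S) = card (trajectory F (m + L) ` S)" if "t \<ge> m + L" for t
        using le'[OF that] ge[of t] le by linarith
    qed
    with le ge[of "m + L"] show ?case by linarith
  qed
  then show ?thesis by blast
qed

lemma coalescence_number_eqI:
  assumes "AE F in iid_maps \<mu>. card (S // coalescence_rel S F) = k"
  shows "coalescence_number S \<mu> = k"
  unfolding coalescence_number_def
proof (rule the_equality)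
  show "AE F in iid_maps \<mu>. card (S // coalescence_rel S F) = k" by (rule assms)
next
  interpret prob_space "iid_maps \<mu>" by (rule prob_space_iid_maps)
  fix k' assume "AE F in iid_maps \<mu>. card (S // coalescence_rel S F) = k'"
  with assms have "AE F in iid_maps \<mu>. k' = k" by eventually_elim simp
  then show "k' = k" by simp
qed

theorem AE_coalescence_number:
  assumes "finite S" "measure_on_self_maps S \<mu>"
  shows "AE F in iid_maps \<mu>. card (S // coalescence_rel S F) = coalescence_number S \<mu>"
  using AE_card_classes_constant[OF assms] coalescence_number_eqI by metis


subsection \<open>The extreme case \<open>k(\<mu>) = |S|\<close>\<close>

text \<open>
  If there is no coalescence at all then \<open>\<mu>\<close> is a block measure for the partition of \<open>S\<close> into
  singletons. Hence a measure on the self-maps of \<open>{1..n}\<close> that is not a block measure never has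
  coalescence number \<open>n\<close>.
\<close>

theorem block_measure_if_coalescence_number_eq:
  assumes \<mu>: "measure_on_self_maps {1..n} \<mu>" and k: "coalescence_number {1..n} \<mu> = n"
  shows "block_measure {1..n} \<mu>"
proof -
  let ?S = "{1..n}"
  interpret prob_space "iid_maps \<mu>" by (rule prob_space_iid_maps)
  have inj: "inj_on f ?S" if f: "f \<in> set_pmf \<mu>" for f
  proof (rule ccontr)
    assume ninj: "\<not> inj_on f ?S"
    let ?A = "{F \<in> space (iid_maps \<mu>). \<forall>s<1. F s = f}"
    have A: "?A \<in> sets (iid_maps \<mu>)" "prob ?A > 0"
      using prob_word_pos[of 1 "\<lambda>_. f" \<mu>] f by auto
    have "AE F in iid_maps \<mu>. F \<notin> ?A"
      using AE_coalescence_number[OF finite_atLeastAtMost \<mu>]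
    proof eventually_elim
      case F: (elim F)
      show "F \<notin> ?A"
      proof
        assume "F \<in> ?A"
        then have "F 0 = f" by simp
        obtain i j where ij: "i \<in> ?S" "j \<in> ?S" "i \<noteq> j" "f i = f j"
          using ninj by (auto simp: inj_on_def)
        let ?R = "coalescence_rel ?S F"
        have "trajectory F (Suc 0) i = trajectory F (Suc 0) j"
          using ij \<open>F 0 = f\<close> by simp
        then have t: "(i, j) \<in> ?R"
          using ij unfolding coalescence_rel_def by fast
        have "?R `` {i} = ?R `` {j}" using equiv_class_eq[OF equiv_coalescence_rel t] .
        then have "?R `` {x} \<in> (\<lambda>x. ?R `` {x}) ` (?S - {i})" if "x \<in> ?S" for x
          using that ij by (cases "x = i") (auto intro!: image_eqI[of _ _ j])
        then have "?S // ?R \<subseteq> (\<lambda>x. ?R `` {x}) ` (?S - {i})"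
          by (auto simp: quotient_def)
        then have "card (?S // ?R) \<le> card ((\<lambda>x. ?R `` {x}) ` (?S - {i}))"
          by (intro card_mono) auto
        also have "\<dots> \<le> card (?S - {i})"
          by (intro card_image_le) auto
        also have "\<dots> < n" using ij by auto
        finally show False using F k by simp
      qed
    qed
    then have "prob ?A = 0"
      using A(1) by (simp add: prob_eq_0)
    with A(2) show False by simp
  qed
  have "\<exists>!\<pi>. \<pi> permutes ?S \<and> (\<forall>r\<in>?S. f ` {r} \<subseteq> {\<pi> r})" if f: "f \<in> set_pmf \<mu>" for f
  proof (rule ex1I)
    define \<pi> where "\<pi> = (\<lambda>r. if r \<in> ?S then f r else r)"
    have "f \<in> ?S \<rightarrow>\<^sub>E ?S" using \<mu> f by (auto simp: measure_on_self_maps_def)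
    then have "f ` ?S \<subseteq> ?S" by (auto dest: PiE_mem)
    then have "bij_betw f ?S ?S"
      using inj[OF f] by (simp add: bij_betw_def endo_inj_surj)
    then have "bij_betw \<pi> ?S ?S"
      by (rule bij_betw_cong[THEN iffD1, rotated]) (simp add: \<pi>_def)
    then have "\<pi> permutes ?S" by (rule bij_imp_permutes) (auto simp: \<pi>_def)
    then show "\<pi> permutes ?S \<and> (\<forall>r\<in>?S. f ` {r} \<subseteq> {\<pi> r})" by (simp add: \<pi>_def)
    fix \<sigma> assume \<sigma>: "\<sigma> permutes ?S \<and> (\<forall>r\<in>?S. f ` {r} \<subseteq> {\<sigma> r})"
    show "\<sigma> = \<pi>"
    proof
      fix r show "\<sigma> r = \<pi> r"
        using \<sigma> by (cases "r \<in> ?S") (auto simp: \<pi>_def permutes_not_in)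
    qed
  qed
  then have "block_measure_wrt ?S n (\<lambda>r. {r}) \<mu>"
    using k by (simp add: block_measure_wrt_def)
  moreover have "indexed_partition ?S n (\<lambda>r. {r})"
    by (auto simp: indexed_partition_def disjoint_family_on_def)
  ultimately show ?thesis unfolding block_measure_def by blast
qed

end

theory Submission
  imports Defs "HOL-Number_Theory.Cong"
begin

text \<open>
  Write \<open>n = l m\<close> and cut \<open>{1..n}\<close> into \<open>m\<close> rows of \<open>l\<close> consecutive points. The random map sends
  every row bijectively onto one common uniformly chosen row, by a uniform cyclic shift that is
  drawn independently for the first row and for the remaining rows. Every point then has a uniform
  image, and the image of \<open>{1..n}\<close> under any composition is a row, so there are exactly \<open>l\<close>
  classes. For a block measure with \<open>l\<close> blocks every map would be constant on each block, so all
  the maps would have the same kernel, but the kernels depend on the two shifts.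
\<close>

section \<open>Rows and shift maps\<close>

definition grid_row :: "nat \<Rightarrow> nat \<Rightarrow> nat set" where
  "grid_row l i = (\<lambda>a. Suc (i * l + a)) ` {..<l}"

text \<open>In a triple \<open>(j, s, t)\<close>, \<open>j\<close> is the target row,
  \<open>s\<close> shifts the first row and \<open>t\<close> all the others. Rows and columns count
  from 0 but points from 1, whence \<open>x - 1\<close> and \<open>Suc\<close>;
  \<open>x \<le> l\<close> singles out row 0.\<close>

definition row_map :: "nat \<Rightarrow> nat \<Rightarrow> nat \<times> nat \<times> nat \<Rightarrow> nat \<Rightarrow> nat" where
  "row_map m l = (\<lambda>(j, s, t). \<lambda>x\<in>{1..l * m}.
     Suc (j * l + ((x - 1) mod l + (if x \<le> l then s else t)) mod l))"

definition row_params :: "nat \<Rightarrow> nat \<Rightarrow> (nat \<times> nat \<times> nat) set" where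
  "row_params m l = {..<m} \<times> {..<l} \<times> {..<l}"

definition row_measure :: "nat \<Rightarrow> nat \<Rightarrow> (nat \<Rightarrow> nat) pmf" where
  "row_measure m l = map_pmf (row_map m l) (pmf_of_set (row_params m l))"

lemma card_grid_row: "card (grid_row l i) = l"
  by (simp add: grid_row_def card_image inj_on_def)

lemma mult_add_less_mult:
  fixes i a l m :: nat
  assumes "i < m" "a < l"
  shows "i * l + a < l * m"
proof -
  have "i * l + a < Suc i * l" using assms by simp
  also have "\<dots> \<le> m * l" using assms by (intro mult_le_mono1) simp
  finally show ?thesis by (simp add: mult.commute)
qed

lemma in_grid_row_iff:
  assumes "l > 0"
  shows "x \<in> grid_row l i \<longleftrightarrow> x > 0 \<and> (x - 1) div l = i"
proof
  assume "x \<in> grid_row l i"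
  then show "x > 0 \<and> (x - 1) div l = i" by (auto simp: grid_row_def)
next
  assume x: "x > 0 \<and> (x - 1) div l = i"
  then have "x = Suc (i * l + (x - 1) mod l)"
    by (metis Suc_pred' div_mult_mod_eq)
  then show "x \<in> grid_row l i"
    using assms unfolding grid_row_def by (intro image_eqI[where x = "(x - 1) mod l"]) auto
qed

lemma UN_grid_row: "l > 0 \<Longrightarrow> (\<Union>i<m. grid_row l i) = {1..l * m}"
  by (auto simp: in_grid_row_iff div_less_iff_less_mult mult.commute)

lemma grid_row_subset: "i < m \<Longrightarrow> grid_row l i \<subseteq> {1..l * m}"
  by (auto simp: grid_row_def Suc_le_eq mult_add_less_mult)

lemma bij_betw_add_mod:
  fixes l s :: nat
  shows "bij_betw (\<lambda>a. (a + s) mod l) {..<l} {..<l}"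
proof (cases "l = 0")
  case False
  have "inj_on (\<lambda>a. (a + s) mod l) {..<l}"
  proof (rule inj_onI)
    fix a b assume "a \<in> {..<l}" "b \<in> {..<l}" "(a + s) mod l = (b + s) mod l"
    then have "[a + s = b + s] (mod l)" by (simp add: cong_def)
    then have "[a = b] (mod l)" by (simp only: cong_add_rcancel_nat)
    then show "a = b"
      using \<open>a \<in> _\<close> \<open>b \<in> _\<close> by (simp add: cong_def)
  qed
  then show ?thesis
    using False unfolding bij_betw_def by (intro conjI endo_inj_surj) auto
qed (simp add: bij_betw_def)

text \<open>A single shift acts on the whole of row \<open>i\<close>, and a cyclic shift permutes
  the columns, so the row fills row \<open>j\<close>.\<close>

lemma row_map_image_grid_row:
  assumes i: "i < m"
  shows "row_map m l (j, s, t) ` grid_row l i = grid_row l j"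
proof (cases "l = 0")
  case False
  let ?u = "if i = 0 then s else t"
  have "row_map m l (j, s, t) (Suc (i * l + a)) = Suc (j * l + (a + ?u) mod l)"
    if "a < l" for a
  proof -
    have "Suc (i * l + a) \<in> {1..l * m}"
      using mult_add_less_mult[OF i that] by simp
    moreover have "Suc (i * l + a) \<le> l \<longleftrightarrow> i = 0"
      using that by (cases i) auto
    ultimately show ?thesis using that by (simp add: row_map_def)
  qed
  then have "row_map m l (j, s, t) ` grid_row l i =
      (\<lambda>b. Suc (j * l + b)) ` (\<lambda>a. (a + ?u) mod l) ` {..<l}"
    by (simp add: grid_row_def image_image)
  also have "(\<lambda>a. (a + ?u) mod l) ` {..<l} = {..<l}"
    using bij_betw_add_mod by (rule bij_betw_imp_surj_on)
  finally show ?thesis by (simp add: grid_row_def)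
qed (simp add: grid_row_def)

lemma row_map_image:
  assumes "l > 0" "m > 0"
  shows "row_map m l (j, s, t) ` {1..l * m} = grid_row l j"
proof -
  have "row_map m l (j, s, t) ` (\<Union>i<m. grid_row l i) = (\<Union>i<m. grid_row l j)"
    by (simp add: image_UN row_map_image_grid_row)
  then show ?thesis using assms by (auto simp: UN_grid_row)
qed

section \<open>The measure and its consistency\<close>

lemma finite_row_params [simp]: "finite (row_params m l)"
  by (simp add: row_params_def)

lemma set_row_measure:
  assumes "l > 0" "m > 0"
  shows "set_pmf (row_measure m l) = row_map m l ` row_params m l"
proof -
  have "row_params m l \<noteq> {}"
    using assms by (auto simp: row_params_def)
  then show ?thesis by (simp add: row_measure_def)
qed

lemma measure_on_self_maps_row_measure:
  assumes "l > 0" "m > 0"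
  shows "measure_on_self_maps {1..l * m} (row_measure m l)"
proof -
  have "row_map m l (j, s, t) \<in> {1..l * m} \<rightarrow>\<^sub>E {1..l * m}" if "j < m" for j s t
  proof (rule PiE_I)
    show "row_map m l (j, s, t) x \<in> {1..l * m}" if "x \<in> {1..l * m}" for x
      using that row_map_image[OF assms, of j s t] grid_row_subset[OF \<open>j < m\<close>, of l] by blast
    show "row_map m l (j, s, t) x = undefined" if "x \<notin> {1..l * m}" for x
      using that by (simp only: row_map_def prod.case restrict_def if_False)
  qed
  then show ?thesis
    unfolding measure_on_self_maps_def set_row_measure[OF assms] row_params_def by blast
qed

text \<open>The row of \<open>y\<close> forces \<open>j\<close>, and the column of \<open>y\<close>
  forces the one shift that acts on \<open>x\<close>. The other shift stays free and contributes the
  \<open>l\<close> choices.\<close>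

lemma card_row_map_eq:
  assumes l: "l > 0" and x: "x \<in> {1..l * m}" and y: "y \<in> {1..l * m}"
  shows "card {p \<in> row_params m l. row_map m l p x = y} = l"
proof -
  define k b where "k = (y - 1) div l" and "b = (y - 1) mod l"
  have k: "k < m" and b: "b < l"
    using y l by (auto simp: k_def b_def div_less_iff_less_mult mult.commute)
  have ykb: "y = Suc (k * l + b)" using y by (auto simp: k_def b_def)
  have decode: "Suc (j * l + c) = y \<longleftrightarrow> j = k \<and> c = b" if "c < l" for j c
  proof
    assume "Suc (j * l + c) = y"
    then have "(j * l + c) div l = (k * l + b) div l" "(j * l + c) mod l = (k * l + b) mod l"
      using ykb by auto
    then show "j = k \<and> c = b" using that b by auto
  qed (simp add: ykb)
  \<comment> \<open>\<open>u\<close> is the unique shift carrying the column of \<open>x\<close> to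
    the column of \<open>y\<close>.\<close>
  obtain u where u: "u < l"
    "\<And>s. s < l \<Longrightarrow> ((x - 1) mod l + s) mod l = b \<longleftrightarrow> s = u"
  proof -
    have *: "bij_betw (\<lambda>s. ((x - 1) mod l + s) mod l) {..<l} {..<l}"
      using bij_betw_add_mod[of "(x - 1) mod l" l] by (simp add: add.commute)
    have "b \<in> (\<lambda>s. ((x - 1) mod l + s) mod l) ` {..<l}"
      unfolding bij_betw_imp_surj_on[OF *] using b by simp
    then obtain u where "u < l" "((x - 1) mod l + u) mod l = b" by blast
    moreover from this have "s = u" if "s < l" "((x - 1) mod l + s) mod l = b" for s
      using * that by (auto simp: bij_betw_def dest!: inj_onD)
    ultimately show thesis using that by blast
  qed
  have eq: "row_map m l (j, s, t) x = y \<longleftrightarrow> j = k \<and> (if x \<le> l then s else t) = u"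
    if "s < l" "t < l" for j s t
    using x that u l by (simp add: row_map_def decode)
  have "(j, s, t) \<in> {p \<in> row_params m l. row_map m l p x = y} \<longleftrightarrow>
      (j, s, t) \<in> (if x \<le> l then {k} \<times> {u} \<times> {..<l} else {k} \<times> {..<l} \<times> {u})" for j s t
    using k u(1)
    by (cases "s < l \<and> t < l") (simp_all add: row_params_def eq, auto)
  then have "{p \<in> row_params m l. row_map m l p x = y} =
      (if x \<le> l then {k} \<times> {u} \<times> {..<l} else {k} \<times> {..<l} \<times> {u})"
    by (simp only: set_eq_iff split_paired_All) blast
  then show ?thesis by (simp add: card_cartesian_product)
qed

lemma consistent_row_measure:
  assumes "l > 0" "m > 0"
  shows "consistent {1..l * m} (row_measure m l) (uniform_matrix (l * m))"
  unfolding consistent_def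
proof (intro ballI)
  let ?S = "{1..l * m}" and ?R = "row_params m l"
  fix x y assume xy: "x \<in> ?S" "y \<in> ?S"
  have ne: "?R \<noteq> {}" using assms by (auto simp: row_params_def)
  have sub: "row_map m l ` ?R \<subseteq> ?S \<rightarrow>\<^sub>E ?S"
    using measure_on_self_maps_row_measure[OF assms]
    by (simp add: measure_on_self_maps_def set_row_measure[OF assms])
  have "measure_pmf.prob (row_measure m l) {f \<in> ?S \<rightarrow>\<^sub>E ?S. f x = y} =
      card (?R \<inter> row_map m l -` {f \<in> ?S \<rightarrow>\<^sub>E ?S. f x = y}) / card ?R"
    by (simp add: row_measure_def measure_pmf_of_set[OF ne])
  also have "?R \<inter> row_map m l -` {f \<in> ?S \<rightarrow>\<^sub>E ?S. f x = y} = {p \<in> ?R. row_map m l p x = y}"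
    using sub by auto
  also have "card \<dots> = l" using assms xy by (intro card_row_map_eq) auto
  \<comment> \<open>Hence the probability is l / (l * l * m) = 1 / (l * m).\<close>
  also have "card ?R = l * (l * m)"
    by (simp add: row_params_def card_cartesian_product)
  finally show "uniform_matrix (l * m) x y =
      measure_pmf.prob (row_measure m l) {f \<in> ?S \<rightarrow>\<^sub>E ?S. f x = y}"
    using assms by (simp add: uniform_matrix_def)
qed

section \<open>Coalescence number\<close>

lemma coalescence_number_row_measure:
  assumes "l > 0" "m > 0"
  shows "coalescence_number {1..l * m} (row_measure m l) = l"
proof (rule coalescence_number_eqI)
  let ?S = "{1..l * m}"
  show "AE F in iid_maps (row_measure m l). card (?S // coalescence_rel ?S F) = l"
    using AE_iid_maps_support[of "row_measure m l"]
  proof eventually_elim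
    case (elim F)
    have image: "\<exists>j<m. F t ` ?S = grid_row l j \<and> (\<forall>i<m. F t ` grid_row l i = grid_row l j)" for t
    proof -
      obtain j s u where "F t = row_map m l (j, s, u)" "j < m"
        using elim[rule_format, of t] by (auto simp: set_row_measure[OF assms] row_params_def)
      then show ?thesis
        using row_map_image[OF assms] row_map_image_grid_row by (intro exI[of _ j]) auto
    qed
    \<comment> \<open>The index starts at \<open>Suc t\<close> because at time 0 the image is still
      all of \<open>?S\<close>. From time 1 on it is a full row, so its size stays
      \<open>l\<close>.\<close>
    have traj: "\<exists>j<m. trajectory F (Suc t) ` ?S = grid_row l j" for t
    proof (induction t)
      case 0
      then show ?case using image[of 0] by auto
    next
      case (Suc t)
      then obtain i where "i < m" "trajectory F (Suc t) ` ?S = grid_row l i" by blast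
      moreover have "trajectory F (Suc (Suc t)) ` ?S = F (Suc t) ` trajectory F (Suc t) ` ?S"
        by (simp add: image_image)
      ultimately show ?case using image[of "Suc t"] by auto
    qed
    have card: "card (trajectory F t ` ?S) = l" if "t \<ge> 1" for t
      using that traj[of "t - 1"] by (auto simp: card_grid_row)
    have "card (?S // coalescence_rel ?S F) = card (trajectory F 1 ` ?S)"
      by (rule card_classes_eq_card_image) (simp_all add: card del: One_nat_def)
    then show ?case by (simp add: card del: One_nat_def)
  qed
qed

section \<open>Failure of the block property\<close>

text \<open>The image meets all \<open>k\<close> blocks but has at most \<open>k\<close> points, so
  it has exactly one point in each. Thus \<open>f\<close> collapses every block to a point and
  separates distinct blocks: its kernel is the partition itself, whatever \<open>f\<close>
  is.\<close>

lemma permuted_blocks_same_kernel: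
  assumes part: "indexed_partition S k B" and fin: "finite S"
    and f: "f ` S \<subseteq> S" "card (f ` S) \<le> k"
    and \<pi>: "\<pi> permutes {1..k}" "\<forall>r\<in>{1..k}. f ` B r \<subseteq> B (\<pi> r)"
    and r: "r \<in> {1..k}" "x \<in> B r" and r': "r' \<in> {1..k}" "y \<in> B r'"
  shows "f x = f y \<longleftrightarrow> r = r'"
proof -
  have B: "B r \<noteq> {}" "B r \<subseteq> S" if "r \<in> {1..k}" for r
    using part that by (auto simp: indexed_partition_def)
  have uniq: "r = s" if "r \<in> {1..k}" "s \<in> {1..k}" "z \<in> B r" "z \<in> B s" for r s z
    using part that unfolding indexed_partition_def disjoint_family_on_def by blast
  have \<pi>_in: "\<pi> r \<in> {1..k}" if "r \<in> {1..k}" for r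
    using permutes_in_image[OF \<pi>(1)] that by blast
  have "\<forall>z\<in>f ` S. \<exists>q\<in>{1..k}. z \<in> B q"
    using part f(1) by (auto simp: indexed_partition_def)
  then obtain idx where idx: "\<And>z. z \<in> f ` S \<Longrightarrow> idx z \<in> {1..k} \<and> z \<in> B (idx z)" by metis
  have idx_f: "idx (f z) = \<pi> q" if "q \<in> {1..k}" "z \<in> B q" for q z
  proof (rule uniq)
    have "f z \<in> f ` S" using B(2) that by blast
    then show "idx (f z) \<in> {1..k}" "f z \<in> B (idx (f z))" using idx by auto
    show "\<pi> q \<in> {1..k}" "f z \<in> B (\<pi> q)" using \<pi>_in \<pi>(2) that by blast+
  qed
  have "\<pi> ` {1..k} \<subseteq> idx ` f ` S"
  proof
    fix p assume "p \<in> \<pi> ` {1..k}"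
    then obtain q where q: "q \<in> {1..k}" "p = \<pi> q" by blast
    obtain z where "z \<in> B q" using B(1)[OF q(1)] by blast
    then have "idx (f z) = p" "z \<in> S" using q idx_f B(2) by auto
    then show "p \<in> idx ` f ` S" by blast
  qed
  then have "k \<le> card (idx ` f ` S)"
    using fin permutes_image[OF \<pi>(1)] card_mono[of "idx ` f ` S" "{1..k}"] by simp
  moreover have "card (idx ` f ` S) \<le> card (f ` S)"
    using fin by (intro card_image_le) auto
  \<comment> \<open>\<open>idx\<close> takes at least \<open>k\<close> values on a set of at most
    \<open>k\<close> points.\<close>
  ultimately have inj: "inj_on idx (f ` S)"
    using f(2) fin by (intro eq_card_imp_inj_on) auto
  have "f x = f y \<longleftrightarrow> idx (f x) = idx (f y)"
    using inj_on_eq_iff[OF inj] r r' B(2) by blast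
  also have "\<dots> \<longleftrightarrow> \<pi> r = \<pi> r'" using idx_f r r' by simp
  also have "\<dots> \<longleftrightarrow> r = r'" using permutes_inj[OF \<pi>(1)] by (simp add: inj_eq)
  finally show ?thesis .
qed

text \<open>The points \<open>1\<close> and \<open>Suc l\<close> share column 0 but lie in the first
  two rows, so independent shifts act on them. Two maps in the support disagree on whether these
  points are identified, while a block measure would give both the same kernel.\<close>

lemma not_block_measure_row_measure:
  assumes l: "l \<ge> 2" and m: "m \<ge> 2"
  shows "\<not> block_measure {1..l * m} (row_measure m l)"
proof
  let ?S = "{1..l * m}"
  have k: "coalescence_number ?S (row_measure m l) = l"
    using l m by (intro coalescence_number_row_measure) auto
  assume "block_measure ?S (row_measure m l)"
  \<comment> \<open>The number of blocks must equal the coalescence number, hence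
    \<open>l\<close>.\<close>
  then obtain B where part: "indexed_partition ?S l B"
    and "block_measure_wrt ?S l B (row_measure m l)"
    using k by (metis block_measure_def block_measure_wrt_def)
  then have perm: "\<exists>\<pi>. \<pi> permutes {1..l} \<and> (\<forall>r\<in>{1..l}. f ` B r \<subseteq> B (\<pi> r))"
    if "f \<in> set_pmf (row_measure m l)" for f
    using that unfolding block_measure_wrt_def by blast
  have "l * 2 \<le> l * m" using m by (rule mult_le_mono2)
  then have S: "1 \<in> ?S" "Suc l \<in> ?S" using l by (simp_all only: atLeastAtMost_iff) linarith+
  then obtain r r' where r: "r \<in> {1..l}" "1 \<in> B r" and r': "r' \<in> {1..l}" "Suc l \<in> B r'"
    using part unfolding indexed_partition_def by blast
  have same: "row_map m l (0, 0, t) 1 = row_map m l (0, 0, t) (Suc l) \<longleftrightarrow> r = r'"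
    if "t < l" for t
  proof -
    have "row_map m l (0, 0, t) \<in> set_pmf (row_measure m l)"
      using that l m by (auto simp: set_row_measure row_params_def)
    then obtain \<pi> where \<pi>: "\<pi> permutes {1..l}"
        "\<forall>r\<in>{1..l}. row_map m l (0, 0, t) ` B r \<subseteq> B (\<pi> r)"
      using perm by blast
    have image: "row_map m l (0, 0, t) ` ?S = grid_row l 0"
      using l m by (intro row_map_image) auto
    show ?thesis
      by (rule permuted_blocks_same_kernel[OF part _ _ _ \<pi> r r'])
        (use m image grid_row_subset[of 0 m l] in \<open>simp_all add: card_grid_row\<close>)
  qed
  have "row_map m l (0, 0, t) 1 = 1" "row_map m l (0, 0, t) (Suc l) = Suc t" if "t < l" for t
    using S l that by (simp_all add: row_map_def)
  \<comment> \<open>The points collide for \<open>t = 0\<close> and are separated for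
    \<open>t = 1\<close>, which is a legal shift since \<open>l \<ge> 2\<close>.\<close>
  then show False using same[of 0] same[of 1] l by simp
qed

text \<open>The case \<open>l = n\<close> has to be excluded: there
  \<open>block_measure_if_coalescence_number_eq\<close> makes every such measure a block measure. In
  the construction, \<open>l \<noteq> n\<close> guarantees a second row.\<close>

theorem theorem6p1:
  fixes n l :: nat
  assumes "n \<ge> 4" and "l > 0" and "l \<noteq> 1" and "l \<noteq> n" and "l dvd n"
  shows "\<exists>\<mu> :: (nat \<Rightarrow> nat) pmf.
           measure_on_self_maps {1..n} \<mu> \<and>
           consistent {1..n} \<mu> (uniform_matrix n) \<and>
           \<not> block_measure {1..n} \<mu> \<and>
           coalescence_number {1..n} \<mu> = l"
proof -
  obtain m where n: "n = l * m" using \<open>l dvd n\<close> by (rule dvdE)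
  have "m \<noteq> 0" "m \<noteq> 1" using assms n by (auto intro: gr0I)
  then have "l \<ge> 2" "m \<ge> 2" using assms by auto
  then show ?thesis
    unfolding n
    using measure_on_self_maps_row_measure[of l m] consistent_row_measure[of l m]
      not_block_measure_row_measure[of l m] coalescence_number_row_measure[of l m]
    by (intro exI[of _ "row_measure m l"]) simp
qed

end
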